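(* Let $x$ be a random clean image with values in $\mathbb{R}^{H\times W\times 3}$, let $w$ be a random binary watermark with values in $\{0,1\}^k$, and let $x_w = E(x,w)\in\mathbb{R}^{H\times W\times 3}$ be the watermarked image. Let $n=\mathcal{A}(x_w,\mu,\sigma,s)$ be the random noise in $\mathbb{R}^{H\times W\times 3}$ produced by the noise intensification procedure $\mathcal{A}$ applied to $x_w$, and let $\hat{x}=\mathcal{M}_\theta(x_w+n)$ be the output of the denoising network $\mathcal{M}_\theta$. Suppose these random variables form the Markov chain $$w \rightarrow x_w \rightarrow x_w+n \rightarrow \hat{x}=\mathcal{M}_\theta(x_w+n).$$ Then $$I(w;\hat{x}) \leq I(w;x_w+n) \leq I(w;x_w).$$
   Context: $I(\cdot\,;\cdot)$ denotes mutual information. A chain of random variables $A\to B\to C\to D$ is a Markov chain if each variable is conditionally independent of all earlier ones given its immediate predecessor; in terms of densities, $p(w,x_w,y,\hat{x})=p(w)\,p(x_w|w)\,p(y|x_w)\,p(\hat{x}|y)$ with $y=x_w+n$. The encoder $E:\mathbb{R}^{H\times W\times 3}\times\{0,1\}^k\to\mathbb{R}^{H\times W\times 3}$ is a (measurable) map embedding the watermark $w$ into the image $x$. The noise intensification $\mathcal{A}(\cdot,\mu,\sigma,s)$ is a randomized map: given an image, it returns noise in $\mathbb{R}^{H\times W\times 3}$, obtained from Gaussian noise of mean $\mu$ and variance $\sigma^2$ weighted by a mask computed from the image (edges detected by the Canny operator, dilated with a structuring element of size $s$, with larger weights on core edges than on their surroundings). Its output is thus a (measurable) function of the image, of the fixed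 parameters $\mu,\sigma,s$, and of exogenous randomness $r$ that is independent of $(w,x_w)$. The denoising network $\mathcal{M}_\theta:\mathbb{R}^{H\times W\times 3}\to\mathbb{R}^{H\times W\times 3}$ is a fixed (measurable) map with parameters $\theta$. *)

theory Defs
  imports "HOL-Probability.Probability"
begin

type_synonym ('h, 'w) image = "real ^ ('h \<times> 'w \<times> 3)"

type_synonym 'k watermark = "bool ^ 'k"

context prob_space
begin

definition rv_sigma :: "'b measure \<Rightarrow> ('a \<Rightarrow> 'b) \<Rightarrow> 'a measure" where
  "rv_sigma S X = vimage_algebra (space M) X S"

text \<open>The library constant \<open>indep_var\<close> forces both variables to have the same value type;
  this is independence of two variables whose value types may differ.\<close>
definition indep_rv :: "'b measure \<Rightarrow> ('a \<Rightarrow> 'b) \<Rightarrow> 'c measure \<Rightarrow> ('a \<Rightarrow> 'c) \<Rightarrow> bool" where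
  "indep_rv S X T Y \<longleftrightarrow>
     random_variable S X \<and> random_variable T Y \<and>
     indep_set (sets (rv_sigma S X)) (sets (rv_sigma T Y))"

text \<open>\<open>X\<close> and \<open>Z\<close> are conditionally independent given \<open>Y\<close>; the conditional probability of an
  event given \<open>Y\<close> is the conditional expectation of its indicator with respect to
  \<open>rv_sigma T Y\<close>. Measurability has to be demanded, because \<^const>\<open>real_cond_exp\<close> is \<open>0\<close> with
  respect to a measure that is not a subalgebra.\<close>
definition cond_indep_rv ::
  "'b measure \<Rightarrow> ('a \<Rightarrow> 'b) \<Rightarrow> 'c measure \<Rightarrow> ('a \<Rightarrow> 'c) \<Rightarrow> 'd measure \<Rightarrow> ('a \<Rightarrow> 'd) \<Rightarrow> bool" where
  "cond_indep_rv S X U Z T Y \<longleftrightarrow>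
     random_variable S X \<and> random_variable U Z \<and> random_variable T Y \<and>
     (\<forall>A\<in>sets S. \<forall>C\<in>sets U. AE \<omega> in M.
        real_cond_exp M (rv_sigma T Y) (\<lambda>\<omega>. indicator A (X \<omega>) * indicator C (Z \<omega>)) \<omega> =
        real_cond_exp M (rv_sigma T Y) (\<lambda>\<omega>. indicator A (X \<omega>)) \<omega> *
        real_cond_exp M (rv_sigma T Y) (\<lambda>\<omega>. indicator C (Z \<omega>)) \<omega>)"

text \<open>The chain \<open>X\<^sub>1 \<rightarrow> X\<^sub>2 \<rightarrow> X\<^sub>3 \<rightarrow> X\<^sub>4\<close>: each variable is conditionally independent of all
  earlier ones, jointly, given its immediate predecessor. For \<open>X\<^sub>2\<close> there is nothing to require.\<close>
definition markov_chain4 ::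
  "'b measure \<Rightarrow> ('a \<Rightarrow> 'b) \<Rightarrow> 'c measure \<Rightarrow> ('a \<Rightarrow> 'c) \<Rightarrow>
   'd measure \<Rightarrow> ('a \<Rightarrow> 'd) \<Rightarrow> 'e measure \<Rightarrow> ('a \<Rightarrow> 'e) \<Rightarrow> bool" where
  "markov_chain4 S1 X1 S2 X2 S3 X3 S4 X4 \<longleftrightarrow>
     cond_indep_rv S3 X3 S1 X1 S2 X2 \<and>
     cond_indep_rv S4 X4 (S1 \<Otimes>\<^sub>M S2) (\<lambda>\<omega>. (X1 \<omega>, X2 \<omega>)) S3 X3"

end

end

theory Submission
  imports Defs
begin

text \<open>
  Since the watermark \<open>W\<close> takes finitely many values, \<open>I(W; X)\<close> is the expected logarithm of
  \<open>q\<^sub>W / p\<^sub>W\<close>, where \<open>p\<^sub>u\<close> is the prior and \<open>q\<^sub>u\<close> the posterior probability of \<open>W = u\<close> given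
  \<open>\<sigma>(X)\<close>. By Gibbs' inequality this expectation decreases when the \<open>\<sigma>\<close>-algebra shrinks. For the
  first inequality \<open>\<sigma>(\<M>(Y)) \<subseteq> \<sigma>(Y)\<close>; for the second \<open>\<sigma>(Y) \<subseteq> \<sigma>(Y, X)\<close>, and conditional
  independence of \<open>Y\<close> and \<open>W\<close> given \<open>X\<close> says that the posteriors given \<open>(Y, X)\<close> and given \<open>X\<close>
  agree.
\<close>

section \<open>Conditional expectations of nonnegative functions\<close>

text \<open>\<open>real_cond_exp\<close> is a difference of two \<open>enn2real\<close> values. For
  nonnegative integrable \<open>f\<close> the negative part contributes zero, and the positive part
  is finite almost everywhere because its integral is finite, so \<open>enn2real\<close> loses
  nothing.\<close>

lemma (in sigma_finite_subalgebra) ennreal_real_cond_exp: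
  assumes int: "integrable M f" and nn: "\<And>x. 0 \<le> f x"
  shows "AE x in M. ennreal (real_cond_exp M F f x) = nn_cond_exp M F (\<lambda>x. ennreal (f x)) x"
proof -
  have [measurable]: "f \<in> borel_measurable M" using int by auto
  have "(\<integral>\<^sup>+ x. nn_cond_exp M F (\<lambda>x. ennreal (f x)) x \<partial>M) = (\<integral>\<^sup>+ x. ennreal (f x) \<partial>M)"
    using nn_cond_exp_intg[of "\<lambda>_. 1" "\<lambda>x. ennreal (f x)"] by simp
  also have "\<dots> \<noteq> \<infinity>"
    using int nn by (simp add: nn_integral_eq_integral)
  finally have "AE x in M. nn_cond_exp M F (\<lambda>x. ennreal (f x)) x \<noteq> \<infinity>"
    by (intro nn_integral_PInf_AE) auto
  moreover have "AE x in M. 0 = nn_cond_exp M F (\<lambda>x. 0) x"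
    by (rule nn_cond_exp_F_meas) auto
  moreover have "(\<lambda>x. ennreal (- f x)) = (\<lambda>_. 0)"
    using nn by (simp add: ennreal_neg)
  ultimately show ?thesis
    by (auto simp: real_cond_exp_def ennreal_enn2real_if elim: AE_mp)
qed

text \<open>The defining property of conditional expectation, stated with nonnegative integrals so
  that the weight \<open>f\<close> may have infinite integral.\<close>

lemma (in sigma_finite_subalgebra) nn_integral_mult_real_cond_exp:
  assumes "integrable M g" "\<And>x. 0 \<le> g x" and [measurable]: "f \<in> borel_measurable F"
  shows "(\<integral>\<^sup>+ x. f x * ennreal (real_cond_exp M F g x) \<partial>M) = (\<integral>\<^sup>+ x. f x * ennreal (g x) \<partial>M)"
proof -
  have [measurable]: "g \<in> borel_measurable M" using assms by auto
  have "(\<integral>\<^sup>+ x. f x * ennreal (real_cond_exp M F g x) \<partial>M) =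
      (\<integral>\<^sup>+ x. f x * nn_cond_exp M F (\<lambda>x. ennreal (g x)) x \<partial>M)"
    using ennreal_real_cond_exp[OF assms(1,2)] by (intro nn_integral_cong_AE) auto
  then show ?thesis by (simp add: nn_cond_exp_intg)
qed

section \<open>Posterior probabilities and their expected logarithm\<close>

context prob_space
begin

definition posterior :: "'a measure \<Rightarrow> ('a \<Rightarrow> 'c) \<Rightarrow> 'c \<Rightarrow> 'a \<Rightarrow> real" where
  "posterior F W u = real_cond_exp M F (\<lambda>\<omega>. indicator {u} (W \<omega>))"

lemma finite_measure_subalgebraI: "subalgebra M F \<Longrightarrow> finite_measure_subalgebra M F"
  by (intro finite_measure_subalgebra.intro finite_measure_axioms
      finite_measure_subalgebra_axioms.intro)

lemma borel_measurable_posterior [measurable]: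
  "posterior F W u \<in> borel_measurable F" "posterior F W u \<in> borel_measurable M"
  by (simp_all add: posterior_def)

lemma integrable_indicator_rv:
  assumes [measurable]: "random_variable S X" "A \<in> sets S"
  shows "integrable M (\<lambda>\<omega>. indicator A (X \<omega>) :: real)"
  by (rule integrable_const_bound[where B = 1]) auto

lemma measurable_indicator_singleton [measurable]:
  fixes u :: 'c
  assumes "random_variable (count_space UNIV) W"
  shows "(\<lambda>\<omega>. indicator {u} (W \<omega>) :: real) \<in> borel_measurable M"
    and "(\<lambda>\<omega>. indicator {u} (W \<omega>) :: ennreal) \<in> borel_measurable M"
  by (rule measurable_compose[OF assms], simp)+

lemma AE_posterior_range:
  assumes F: "subalgebra M F" and [measurable]: "random_variable (count_space UNIV) W"
  shows "AE \<omega> in M. 0 \<le> posterior F W u \<omega> \<and> posterior F W u \<omega> \<le> 1"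
proof -
  interpret F: finite_measure_subalgebra M F by (rule finite_measure_subalgebraI[OF F])
  have int: "integrable M (\<lambda>\<omega>. indicator {u} (W \<omega>) :: real)"
    by (rule integrable_indicator_rv[where S = "count_space UNIV"]) auto
  have "AE \<omega> in M. 0 \<le> posterior F W u \<omega>"
    unfolding posterior_def by (rule F.real_cond_exp_pos) auto
  moreover have "AE \<omega> in M. posterior F W u \<omega> \<le> real_cond_exp M F (\<lambda>_. 1) \<omega>"
    unfolding posterior_def by (rule F.real_cond_exp_mono[OF _ int]) auto
  moreover have "AE \<omega> in M. real_cond_exp M F (\<lambda>_. 1) \<omega> = 1"
    by (rule F.real_cond_exp_F_meas) auto
  ultimately show ?thesis by eventually_elim auto
qed

text \<open>Uniqueness of conditional expectation. The test sets are compared through nonnegative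
  integrals, and the result returns to the reals because \<open>ennreal\<close> is injective on
  nonnegative numbers.\<close>

lemma posterior_eqI:
  assumes F: "subalgebra M F" and W[measurable]: "random_variable (count_space UNIV) W"
    and g[measurable]: "g \<in> borel_measurable F" and nn: "AE \<omega> in M. 0 \<le> g \<omega>"
    and eq: "\<And>A. A \<in> sets F \<Longrightarrow>
      (\<integral>\<^sup>+ \<omega>. ennreal (g \<omega>) * indicator A \<omega> \<partial>M) = (\<integral>\<^sup>+ \<omega>. indicator {u} (W \<omega>) * indicator A \<omega> \<partial>M)"
  shows "AE \<omega> in M. posterior F W u \<omega> = g \<omega>"
proof -
  interpret F: finite_measure_subalgebra M F by (rule finite_measure_subalgebraI[OF F])
  let ?i = "\<lambda>\<omega>. indicator {u} (W \<omega>) :: real"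
  have "AE \<omega> in M. ennreal (g \<omega>) = nn_cond_exp M F (\<lambda>\<omega>. ennreal (?i \<omega>)) \<omega>"
    by (rule F.nn_cond_exp_charact) (use eq in \<open>auto simp: ennreal_indicator\<close>)
  moreover have "AE \<omega> in M. ennreal (posterior F W u \<omega>) = nn_cond_exp M F (\<lambda>\<omega>. ennreal (?i \<omega>)) \<omega>"
    unfolding posterior_def
    by (intro F.ennreal_real_cond_exp integrable_indicator_rv[OF W]) auto
  moreover note AE_posterior_range[OF F W, of u] nn
  ultimately show ?thesis
    by eventually_elim (metis ennreal_inj)
qed

text \<open>Split the integral according to the value of \<open>W\<close>; on each piece
  \<open>H u\<close> is \<open>F\<close>-measurable, so the indicator of \<open>W = u\<close> may be
  replaced by its conditional expectation.\<close>

lemma nn_integral_posterior: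
  fixes W :: "'a \<Rightarrow> 'c :: finite"
  assumes F: "subalgebra M F" and W[measurable]: "random_variable (count_space UNIV) W"
    and H: "\<And>u. H u \<in> borel_measurable F"
  shows "(\<integral>\<^sup>+ \<omega>. H (W \<omega>) \<omega> \<partial>M) = (\<Sum>u\<in>UNIV. \<integral>\<^sup>+ \<omega>. H u \<omega> * ennreal (posterior F W u \<omega>) \<partial>M)"
proof -
  interpret F: finite_measure_subalgebra M F by (rule finite_measure_subalgebraI[OF F])
  have [measurable]: "H u \<in> borel_measurable M" for u
    using H measurable_from_subalg[OF F] by blast
  have "(\<integral>\<^sup>+ \<omega>. H (W \<omega>) \<omega> \<partial>M) =
      (\<integral>\<^sup>+ \<omega>. (\<Sum>u\<in>UNIV. H u \<omega> * ennreal (indicator {u} (W \<omega>))) \<partial>M)"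
    by (intro nn_integral_cong) (simp add: ennreal_indicator indicator_def of_bool_def if_distrib sum.delta cong: if_cong)
  also have "\<dots> = (\<Sum>u\<in>UNIV. \<integral>\<^sup>+ \<omega>. H u \<omega> * ennreal (indicator {u} (W \<omega>)) \<partial>M)"
    by (intro nn_integral_sum) measurable
  also have "\<dots> = (\<Sum>u\<in>UNIV. \<integral>\<^sup>+ \<omega>. H u \<omega> * ennreal (posterior F W u \<omega>) \<partial>M)"
    unfolding posterior_def
    by (intro sum.cong refl F.nn_integral_mult_real_cond_exp[symmetric] integrable_indicator_rv[OF W] H) auto
  finally show ?thesis .
qed

lemma measurable_compose_finite:
  fixes W :: "'a \<Rightarrow> 'c :: finite"
  assumes "random_variable (count_space UNIV) W" and "\<And>u. f u \<in> measurable M N"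
  shows "(\<lambda>\<omega>. f (W \<omega>) \<omega>) \<in> measurable M N"
  by (rule measurable_compose_countable[OF _ assms(1)]) (rule assms(2))

text \<open>The actual value of \<open>W\<close> almost never has posterior zero: averaging the
  indicator of that event against the posterior weights gives zero.\<close>

lemma AE_posterior_pos:
  fixes W :: "'a \<Rightarrow> 'c :: finite"
  assumes F: "subalgebra M F" and W[measurable]: "random_variable (count_space UNIV) W"
  shows "AE \<omega> in M. 0 < posterior F W (W \<omega>) \<omega>"
proof -
  let ?H = "\<lambda>u \<omega>. if posterior F W u \<omega> \<le> 0 then 1 else 0 :: ennreal"
  have m: "?H u \<in> borel_measurable F" for u by measurable
  have [measurable]: "(\<lambda>\<omega>. ?H (W \<omega>) \<omega>) \<in> borel_measurable M"
    by (rule measurable_compose_finite[OF W]) measurable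
  have "(\<integral>\<^sup>+ \<omega>. ?H (W \<omega>) \<omega> \<partial>M) = (\<Sum>u\<in>UNIV. \<integral>\<^sup>+ \<omega>. ?H u \<omega> * ennreal (posterior F W u \<omega>) \<partial>M)"
    by (rule nn_integral_posterior[OF F W m])
  \<comment> \<open>Where \<open>?H u\<close> equals 1 the posterior is at most 0, and
    \<open>ennreal\<close> sends it to 0.\<close>
  also have "\<dots> = (\<Sum>u\<in>(UNIV :: 'c set). \<integral>\<^sup>+ \<omega>. 0 \<partial>M)"
    by (intro sum.cong refl nn_integral_cong) (auto simp: ennreal_neg)
  finally have "AE \<omega> in M. ?H (W \<omega>) \<omega> = 0"
    using nn_integral_0_iff_AE[of "\<lambda>\<omega>. ?H (W \<omega>) \<omega>" M] by simp
  then show ?thesis by eventually_elim (auto split: if_splits)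
qed

text \<open>The logarithm is unbounded near 0, but weighting it by the posterior itself tames it:
  \<open>\<bar>ln q\<bar> * q\<close> is bounded on the unit interval, and there are only finitely
  many values of \<open>W\<close>.\<close>

lemma integrable_ln_posterior:
  fixes W :: "'a \<Rightarrow> 'c :: finite"
  assumes F: "subalgebra M F" and W[measurable]: "random_variable (count_space UNIV) W"
  shows "integrable M (\<lambda>\<omega>. ln (posterior F W (W \<omega>) \<omega>))"
proof (rule integrableI_bounded)
  show "(\<lambda>\<omega>. ln (posterior F W (W \<omega>) \<omega>)) \<in> borel_measurable M"
    by (rule measurable_compose_finite[OF W]) measurable
  let ?H = "\<lambda>u \<omega>. ennreal (norm (ln (posterior F W u \<omega>)))"
  have m: "?H u \<in> borel_measurable F" for u by measurable
  have le: "\<bar>ln q\<bar> * q \<le> 1" if "0 \<le> q" "q \<le> 1" for q :: real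
  proof (cases "q = 0")
    case False
    then have "- ln q * q \<le> (1 / q - 1) * q"
      using that ln_le_minus_one[of "1 / q"] by (intro mult_right_mono) (auto simp: ln_div)
    also have "\<dots> \<le> 1" using that False by (simp add: field_simps)
    finally show ?thesis using that False by (simp add: abs_if)
  qed auto
  have "(\<integral>\<^sup>+ \<omega>. ?H (W \<omega>) \<omega> \<partial>M) = (\<Sum>u\<in>UNIV. \<integral>\<^sup>+ \<omega>. ?H u \<omega> * ennreal (posterior F W u \<omega>) \<partial>M)"
    by (rule nn_integral_posterior[OF F W m])
  also have "\<dots> \<le> (\<Sum>u\<in>(UNIV :: 'c set). \<integral>\<^sup>+ \<omega>. 1 \<partial>M)"
  proof (intro sum_mono nn_integral_mono_AE)
    fix u
    show "AE \<omega> in M. ?H u \<omega> * ennreal (posterior F W u \<omega>) \<le> 1"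
      using AE_posterior_range[OF F W, of u]
      by eventually_elim (auto simp: ennreal_mult[symmetric] intro: le)
  qed
  also have "\<dots> < \<infinity>" by (simp add: emeasure_space_1 of_nat_less_top)
  finally show "(\<integral>\<^sup>+ \<omega>. ?H (W \<omega>) \<omega> \<partial>M) < \<infinity>" .
qed

text \<open>The ratio of the two posteriors has expectation at most one, so
  \<open>ln t \<le> t - 1\<close> makes the expectation of its logarithm nonpositive.\<close>

lemma integral_ln_posterior_mono:
  fixes W :: "'a \<Rightarrow> 'c :: finite"
  assumes F: "subalgebra M F" and G: "subalgebra M G" and FG: "subalgebra G F"
    and W[measurable]: "random_variable (count_space UNIV) W"
  shows "(\<integral>\<omega>. ln (posterior F W (W \<omega>) \<omega>) \<partial>M) \<le> (\<integral>\<omega>. ln (posterior G W (W \<omega>) \<omega>) \<partial>M)"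
proof -
  \<comment> \<open>\<open>subalgebra G F\<close> makes \<open>F\<close> the coarser algebra, so
    \<open>?c\<close> is the coarse and \<open>?a\<close> the fine posterior. Both are
    \<open>G\<close>-measurable, hence the ratio can be averaged with the weights
    \<open>?a\<close>.\<close>
  let ?c = "posterior F W" and ?a = "posterior G W"
  let ?H = "\<lambda>u \<omega>. ennreal (?c u \<omega> / ?a u \<omega>)"
  have [measurable]: "?c u \<in> borel_measurable G" for u
    by (rule measurable_from_subalg[OF FG borel_measurable_posterior(1)])
  have m: "?H u \<in> borel_measurable G" for u by measurable
  have [measurable]: "(\<lambda>\<omega>. ?c (W \<omega>) \<omega> / ?a (W \<omega>) \<omega>) \<in> borel_measurable M"
    by (rule measurable_compose_finite[OF W, of "\<lambda>u \<omega>. ?c u \<omega> / ?a u \<omega>"]) measurable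
  have pos: "AE \<omega> in M. 0 < ?c (W \<omega>) \<omega>" "AE \<omega> in M. 0 < ?a (W \<omega>) \<omega>"
    using AE_posterior_pos F G W by blast+
  have "(\<integral>\<^sup>+ \<omega>. ?H (W \<omega>) \<omega> \<partial>M) = (\<Sum>u\<in>UNIV. \<integral>\<^sup>+ \<omega>. ?H u \<omega> * ennreal (?a u \<omega>) \<partial>M)"
    by (rule nn_integral_posterior[OF G W m])
  also have "\<dots> \<le> (\<Sum>u\<in>UNIV. \<integral>\<^sup>+ \<omega>. 1 * ennreal (?c u \<omega>) \<partial>M)"
  proof (intro sum_mono nn_integral_mono_AE)
    fix u
    \<comment> \<open>Only an inequality: where \<open>?a u\<close> vanishes, the quotient is 0 by
      convention.\<close>
    show "AE \<omega> in M. ?H u \<omega> * ennreal (?a u \<omega>) \<le> 1 * ennreal (?c u \<omega>)"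
      using AE_posterior_range[OF F W, of u] AE_posterior_range[OF G W, of u]
      by eventually_elim (auto simp: ennreal_mult[symmetric] intro!: ennreal_leI)
  qed
  also have "\<dots> = (\<integral>\<^sup>+ \<omega>. 1 \<partial>M)"
    by (rule nn_integral_posterior[OF F W, symmetric]) auto
  finally have nn: "(\<integral>\<^sup>+ \<omega>. ?H (W \<omega>) \<omega> \<partial>M) \<le> 1" by (simp add: emeasure_space_1)
  have int: "integrable M (\<lambda>\<omega>. ?c (W \<omega>) \<omega> / ?a (W \<omega>) \<omega>)"
    using nn pos by (intro integrableI_nonneg) (auto elim: AE_mp intro: le_less_trans)
  have le1: "(\<integral>\<omega>. ?c (W \<omega>) \<omega> / ?a (W \<omega>) \<omega> \<partial>M) \<le> 1"
  proof -
    have "ennreal (\<integral>\<omega>. ?c (W \<omega>) \<omega> / ?a (W \<omega>) \<omega> \<partial>M) = (\<integral>\<^sup>+ \<omega>. ?H (W \<omega>) \<omega> \<partial>M)"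
      using pos by (intro nn_integral_eq_integral[symmetric] int) (auto elim: AE_mp)
    then show ?thesis using nn by (metis ennreal_le_1)
  qed
  note intc = integrable_ln_posterior[OF F W] and inta = integrable_ln_posterior[OF G W]
  have "(\<integral>\<omega>. ln (?c (W \<omega>) \<omega>) \<partial>M) - (\<integral>\<omega>. ln (?a (W \<omega>) \<omega>) \<partial>M) =
      (\<integral>\<omega>. ln (?c (W \<omega>) \<omega>) - ln (?a (W \<omega>) \<omega>) \<partial>M)"
    using intc inta by simp
  also have "\<dots> \<le> (\<integral>\<omega>. ?c (W \<omega>) \<omega> / ?a (W \<omega>) \<omega> - 1 \<partial>M)"
  proof (rule integral_mono_AE)
    show "AE \<omega> in M. ln (?c (W \<omega>) \<omega>) - ln (?a (W \<omega>) \<omega>) \<le> ?c (W \<omega>) \<omega> / ?a (W \<omega>) \<omega> - 1"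
      using pos by eventually_elim (metis divide_pos_pos ln_divide_pos ln_le_minus_one)
  qed (use intc inta int in auto)
  also have "\<dots> \<le> 0" using int le1 by (simp add: prob_space)
  finally show ?thesis by simp
qed

section \<open>Generated sigma-algebras and conditional independence\<close>

lemma space_rv_sigma [simp]: "space (rv_sigma T X) = space M"
  by (simp add: rv_sigma_def)

lemma measurable_rv_sigma: "random_variable T X \<Longrightarrow> X \<in> measurable (rv_sigma T X) T"
  unfolding rv_sigma_def by (rule measurable_vimage_algebra1) (auto dest: measurable_space)

lemma subalgebra_rv_sigma: "random_variable T X \<Longrightarrow> subalgebra M (rv_sigma T X)"
  unfolding subalgebra_def rv_sigma_def by (simp add: sets_image_in_sets)

lemma subalgebra_rv_sigma_comp:
  assumes "random_variable T X" and f: "f \<in> measurable T V"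
  shows "subalgebra (rv_sigma T X) (rv_sigma V (\<lambda>\<omega>. f (X \<omega>)))"
proof -
  have "(\<lambda>\<omega>. f (X \<omega>)) \<in> measurable (rv_sigma T X) V"
    using measurable_rv_sigma[OF assms(1)] f by (rule measurable_compose)
  then have "sets (vimage_algebra (space M) (\<lambda>\<omega>. f (X \<omega>)) V) \<subseteq> sets (rv_sigma T X)"
    by (intro sets_image_in_sets) auto
  then show ?thesis by (simp add: subalgebra_def) (simp add: rv_sigma_def)
qed

lemma rv_sigmaE:
  assumes "random_variable T X" "A \<in> sets (rv_sigma T X)"
  obtains B where "B \<in> sets T" "A = X -` B \<inter> space M"
  using assms by (auto simp: rv_sigma_def sets_vimage_algebra2 measurable_def)

text \<open>The density-free form of p(w | y, x) = p(w | x). The posterior given \<open>X\<close> is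
  already measurable for the larger algebra, so only its integrals over events of
  \<open>(Y, X)\<close> need checking, and by a pi-system argument rectangles suffice.\<close>

lemma posterior_cond_indep:
  assumes ci: "cond_indep_rv T Y (count_space UNIV) W V X"
  shows "AE \<omega> in M. posterior (rv_sigma (T \<Otimes>\<^sub>M V) (\<lambda>\<omega>. (Y \<omega>, X \<omega>))) W u \<omega> = posterior (rv_sigma V X) W u \<omega>"
proof -
  have Y[measurable]: "random_variable T Y" and W[measurable]: "random_variable (count_space UNIV) W"
    and X[measurable]: "random_variable V X"
    using ci by (auto simp: cond_indep_rv_def)
  let ?F = "rv_sigma V X" and ?Z = "\<lambda>\<omega>. (Y \<omega>, X \<omega>)"
  let ?G = "rv_sigma (T \<Otimes>\<^sub>M V) ?Z"
  let ?q = "posterior ?F W u"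
  have Z[measurable]: "random_variable (T \<Otimes>\<^sub>M V) ?Z" by measurable
  have F: "subalgebra M ?F" and G: "subalgebra M ?G"
    by (intro subalgebra_rv_sigma X Z)+
  have FG: "subalgebra ?G ?F"
    using subalgebra_rv_sigma_comp[OF Z measurable_snd] by simp
  interpret F: finite_measure_subalgebra M ?F by (rule finite_measure_subalgebraI[OF F])
  have XF[measurable]: "X \<in> measurable ?F V" by (rule measurable_rv_sigma[OF X])
  \<comment> \<open>The two sides of the required integral identity, viewed as measures on the
    product space.\<close>
  let ?N1 = "distr (density M (\<lambda>\<omega>. ennreal (?q \<omega>))) (T \<Otimes>\<^sub>M V) ?Z"
  let ?N2 = "distr (density M (\<lambda>\<omega>. indicator {u} (W \<omega>))) (T \<Otimes>\<^sub>M V) ?Z"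
  have N1: "emeasure ?N1 A = (\<integral>\<^sup>+ \<omega>. ennreal (?q \<omega>) * indicator A (?Z \<omega>) \<partial>M)"
    and N2: "emeasure ?N2 A = (\<integral>\<^sup>+ \<omega>. indicator {u} (W \<omega>) * indicator A (?Z \<omega>) \<partial>M)"
    if [measurable]: "A \<in> sets (T \<Otimes>\<^sub>M V)" for A
    by (auto simp: emeasure_distr emeasure_density intro!: nn_integral_cong split: split_indicator)
  have rect: "emeasure ?N1 (B \<times> C) = emeasure ?N2 (B \<times> C)"
    if B[measurable]: "B \<in> sets T" and C[measurable]: "C \<in> sets V" for B C
  proof -
    \<comment> \<open>The factor depending on \<open>X\<close> is \<open>?F\<close>-measurable, so
      the indicator of \<open>B\<close> can be conditioned to \<open>?r\<close>. Conditional
      independence turns \<open>?r * ?q\<close> into \<open>?s\<close>, and conditioning is then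
      undone.\<close>
    let ?r = "real_cond_exp M ?F (\<lambda>\<omega>. indicator B (Y \<omega>))"
    let ?s = "real_cond_exp M ?F (\<lambda>\<omega>. indicator B (Y \<omega>) * indicator {u} (W \<omega>))"
    have "emeasure ?N1 (B \<times> C) =
        (\<integral>\<^sup>+ \<omega>. (indicator C (X \<omega>) * ennreal (?q \<omega>)) * ennreal (indicator B (Y \<omega>)) \<partial>M)"
      by (subst N1; force intro!: nn_integral_cong split: split_indicator)
    also have "\<dots> = (\<integral>\<^sup>+ \<omega>. (indicator C (X \<omega>) * ennreal (?q \<omega>)) * ennreal (?r \<omega>) \<partial>M)"
      by (intro F.nn_integral_mult_real_cond_exp[symmetric] integrable_indicator_rv[OF Y]) auto
    also have "\<dots> = (\<integral>\<^sup>+ \<omega>. indicator C (X \<omega>) * ennreal (?s \<omega>) \<partial>M)"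
    proof (rule nn_integral_cong_AE)
      have "AE \<omega> in M. ?s \<omega> = ?r \<omega> * ?q \<omega>"
        using ci B unfolding cond_indep_rv_def posterior_def by auto
      moreover have "AE \<omega> in M. 0 \<le> ?r \<omega>" by (rule F.real_cond_exp_pos) auto
      moreover note AE_posterior_range[OF F W, of u]
      ultimately show "AE \<omega> in M. (indicator C (X \<omega>) * ennreal (?q \<omega>)) * ennreal (?r \<omega>) =
          indicator C (X \<omega>) * ennreal (?s \<omega>)"
        by eventually_elim (simp add: ennreal_mult ac_simps)
    qed
    also have "\<dots> = (\<integral>\<^sup>+ \<omega>. indicator C (X \<omega>) * ennreal (indicator B (Y \<omega>) * indicator {u} (W \<omega>)) \<partial>M)"
      by (intro F.nn_integral_mult_real_cond_exp integrable_const_bound[where B = 1])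
        (auto split: split_indicator)
    also have "\<dots> = emeasure ?N2 (B \<times> C)"
      by (subst N2; force intro!: nn_integral_cong split: split_indicator)
    finally show ?thesis .
  qed
  \<comment> \<open>Uniqueness of measures needs an exhausting sequence of finite measure. The whole
    space is itself a rectangle, so a constant sequence works and the bound for \<open>?N2\<close>
    carries over to \<open>?N1\<close>.\<close>
  have fin: "emeasure ?N1 (space T \<times> space V) \<noteq> \<infinity>"
  proof -
    have "emeasure ?N2 (space T \<times> space V) \<le> (\<integral>\<^sup>+ \<omega>. 1 \<partial>M)"
      by (subst N2; force intro!: nn_integral_mono split: split_indicator)
    also have "\<dots> < \<infinity>" by (simp add: emeasure_space_1)
    finally show ?thesis using rect[of "space T" "space V"] by auto
  qed
  have N: "?N1 = ?N2"
  proof (rule measure_eqI_generator_eq[OF Int_stable_pair_measure_generator[of T V],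
        where \<Omega> = "space T \<times> space V" and A = "\<lambda>_. space T \<times> space V"])
    show "{a \<times> b |a b. a \<in> sets T \<and> b \<in> sets V} \<subseteq> Pow (space T \<times> space V)"
      by (auto dest: sets.sets_into_space)
    show "range (\<lambda>_. space T \<times> space V) \<subseteq> {a \<times> b |a b. a \<in> sets T \<and> b \<in> sets V}"
      by blast
    show "emeasure ?N1 R = emeasure ?N2 R" if "R \<in> {a \<times> b |a b. a \<in> sets T \<and> b \<in> sets V}" for R
      using that rect by blast
  qed (use fin in \<open>simp_all add: sets_pair_measure\<close>)
  show ?thesis
  proof (rule posterior_eqI[OF G W])
    show "?q \<in> borel_measurable ?G"
      by (rule measurable_from_subalg[OF FG borel_measurable_posterior(1)])
    show "AE \<omega> in M. 0 \<le> ?q \<omega>" using AE_posterior_range[OF F W, of u] by auto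
    fix A assume "A \<in> sets ?G"
    then obtain B where B: "B \<in> sets (T \<Otimes>\<^sub>M V)" "A = ?Z -` B \<inter> space M"
      by (rule rv_sigmaE[OF Z])
    have "(\<integral>\<^sup>+ \<omega>. ennreal (?q \<omega>) * indicator A \<omega> \<partial>M) = emeasure ?N1 B"
      unfolding N1[OF B(1)] B(2) by (intro nn_integral_cong) (simp split: split_indicator)
    also have "\<dots> = (\<integral>\<^sup>+ \<omega>. indicator {u} (W \<omega>) * indicator A \<omega> \<partial>M)"
      unfolding N N2[OF B(1)] B(2) by (intro nn_integral_cong) (simp split: split_indicator)
    finally show "(\<integral>\<^sup>+ \<omega>. ennreal (?q \<omega>) * indicator A \<omega> \<partial>M) =
      (\<integral>\<^sup>+ \<omega>. indicator {u} (W \<omega>) * indicator A \<omega> \<partial>M)" .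
  qed
qed

section \<open>Mutual information as the expected log ratio of posterior to prior\<close>

text \<open>Guarantees that the Radon-Nikodym derivative in \<open>mutual_information\<close> is a
  genuine density. It rests on \<open>W\<close> having finitely many values: a product-null set has
  null sections at every value that \<open>W\<close> takes with positive probability.\<close>

lemma absolutely_continuous_joint_distr:
  fixes W :: "'a \<Rightarrow> 'c :: finite"
  assumes W[measurable]: "random_variable (count_space UNIV) W" and X[measurable]: "random_variable T X"
  shows "absolutely_continuous (distr M (count_space UNIV) W \<Otimes>\<^sub>M distr M T X)
    (distr M (count_space UNIV \<Otimes>\<^sub>M T) (\<lambda>\<omega>. (W \<omega>, X \<omega>)))"
  unfolding absolutely_continuous_def
proof
  interpret PW: prob_space "distr M (count_space UNIV) W" by (rule prob_space_distr) fact
  interpret PX: prob_space "distr M T X" by (rule prob_space_distr) fact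
  interpret P: pair_prob_space "distr M (count_space UNIV) W" "distr M T X" ..
  fix A assume A: "A \<in> null_sets (distr M (count_space UNIV) W \<Otimes>\<^sub>M distr M T X)"
  have "sets (distr M (count_space UNIV) W \<Otimes>\<^sub>M distr M T X) = sets (count_space UNIV \<Otimes>\<^sub>M T)"
    by (rule sets_pair_measure_cong) auto
  then have [measurable]: "A \<in> sets (count_space UNIV \<Otimes>\<^sub>M T)"
    using A by (auto simp: null_sets_def)
  have "AE u in distr M (count_space UNIV) W. AE x in distr M T X. (u, x) \<notin> A"
    using AE_not_in[OF A] by (rule P.AE_pair)
  then have "AE \<omega> in M. AE x in distr M T X. (W \<omega>, x) \<notin> A"
    by (rule AE_distrD[OF W])
  then have ae: "AE \<omega> in M. AE \<omega>' in M. (W \<omega>, X \<omega>') \<notin> A"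
    by eventually_elim (rule AE_distrD[OF X])
  have "AE \<omega> in M. W \<omega> = u \<longrightarrow> (u, X \<omega>) \<notin> A" for u
  proof (cases "AE \<omega>' in M. (u, X \<omega>') \<notin> A")
    \<comment> \<open>If the section at \<open>u\<close> is not null, \<open>ae\<close> forces
      \<open>W\<close> to differ from \<open>u\<close> almost everywhere.\<close>
    case False
    then show ?thesis using ae by (auto elim!: AE_mp)
  qed auto
  then have "AE \<omega> in M. \<forall>u. W \<omega> = u \<longrightarrow> (u, X \<omega>) \<notin> A"
    by (subst AE_all_countable) auto
  then have "AE \<omega> in M. (W \<omega>, X \<omega>) \<notin> A" by auto
  then have "AE z in distr M (count_space UNIV \<Otimes>\<^sub>M T) (\<lambda>\<omega>. (W \<omega>, X \<omega>)). z \<notin> A"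
    by (subst AE_distr_iff) auto
  then show "A \<in> null_sets (distr M (count_space UNIV \<Otimes>\<^sub>M T) (\<lambda>\<omega>. (W \<omega>, X \<omega>)))"
    by (subst AE_iff_null_sets) auto
qed

text \<open>Bayes' rule: the density \<open>D\<close> of the joint law against the product law is
  posterior over prior. The prior term depends on \<open>W\<close> alone, so it cancels when two
  observations are compared.\<close>

lemma mutual_information_eq_posterior:
  fixes W :: "'a \<Rightarrow> 'c :: finite"
  assumes W[measurable]: "random_variable (count_space UNIV) W" and X[measurable]: "random_variable T X"
  shows "mutual_information b (count_space UNIV) T W X =
    ((\<integral>\<omega>. ln (posterior (rv_sigma T X) W (W \<omega>) \<omega>) \<partial>M) - (\<integral>\<omega>. ln (\<P>(\<omega>' in M. W \<omega>' = W \<omega>)) \<partial>M)) / ln b"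
proof -
  let ?S = "count_space UNIV :: 'c measure"
  let ?P = "distr M ?S W \<Otimes>\<^sub>M distr M T X" and ?Z = "\<lambda>\<omega>. (W \<omega>, X \<omega>)"
  let ?Q = "distr M (?S \<Otimes>\<^sub>M T) ?Z" and ?F = "rv_sigma T X"
  define p where "p u = \<P>(\<omega>' in M. W \<omega>' = u)" for u
  have F: "subalgebra M ?F" by (rule subalgebra_rv_sigma[OF X])
  have XF: "X \<in> measurable ?F T" by (rule measurable_rv_sigma[OF X])
  interpret PW: prob_space "distr M ?S W" by (rule prob_space_distr) fact
  interpret PX: prob_space "distr M T X" by (rule prob_space_distr) fact
  interpret P: pair_prob_space "distr M ?S W" "distr M T X" ..
  interpret Q: prob_space ?Q by (rule prob_space_distr) measurable
  have ac: "absolutely_continuous ?P ?Q" by (rule absolutely_continuous_joint_distr[OF W X])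
  have [measurable_cong]: "sets ?P = sets (?S \<Otimes>\<^sub>M T)" by (rule sets_pair_measure_cong) auto
  then have sets: "sets ?Q = sets ?P" by simp
  define D where "D z = enn2real (RN_deriv ?P ?Q z)" for z
  have D[measurable]: "D \<in> borel_measurable (?S \<Otimes>\<^sub>M T)"
    unfolding D_def by measurable
  \<comment> \<open>\<open>enn2real\<close> sends infinity to 0, so finiteness is needed for
    \<open>D\<close> to remain a density.\<close>
  have "AE z in ?P. RN_deriv ?P ?Q z \<noteq> \<infinity>"
    by (rule P.RN_deriv_finite[OF _ ac sets]) unfold_locales
  then have "density ?P (\<lambda>z. ennreal (D z)) = density ?P (RN_deriv ?P ?Q)"
    unfolding D_def by (intro density_cong) (auto elim: AE_mp simp: less_top)
  then have dens: "density ?P (\<lambda>z. ennreal (D z)) = ?Q"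
    using P.density_RN_deriv[OF ac sets] by simp
  \<comment> \<open>Tested on events \<open>X\<close> in \<open>B\<close>: the joint law of
    \<open>{u} \<times> B\<close> is computed from \<open>D\<close> by Fubini, and the integral over
    the \<open>W\<close> coordinate leaves the factor \<open>p u\<close>.\<close>
  have post: "AE \<omega> in M. posterior ?F W u \<omega> = p u * D (u, X \<omega>)" for u
  proof (rule posterior_eqI[OF F W])
    show "(\<lambda>\<omega>. p u * D (u, X \<omega>)) \<in> borel_measurable ?F"
      using XF by measurable
    show "AE \<omega> in M. 0 \<le> p u * D (u, X \<omega>)" by (simp add: p_def D_def)
    fix A assume "A \<in> sets ?F"
    then obtain B where B[measurable]: "B \<in> sets T" and A: "A = X -` B \<inter> space M"
      by (rule rv_sigmaE[OF X])
    have "(\<integral>\<^sup>+ \<omega>. indicator {u} (W \<omega>) * indicator A \<omega> \<partial>M) =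
        (\<integral>\<^sup>+ \<omega>. indicator ({u} \<times> B) (?Z \<omega>) \<partial>M)"
      unfolding A by (intro nn_integral_cong) (simp split: split_indicator)
    also have "\<dots> = (\<integral>\<^sup>+ z. indicator ({u} \<times> B) z \<partial>?Q)"
      by (subst nn_integral_distr) auto
    also have "\<dots> = (\<integral>\<^sup>+ z. ennreal (D z) * indicator ({u} \<times> B) z \<partial>?P)"
      unfolding dens[symmetric] by (subst nn_integral_density) auto
    also have "\<dots> = (\<integral>\<^sup>+ v. \<integral>\<^sup>+ x. ennreal (D (v, x)) * indicator ({u} \<times> B) (v, x) \<partial>distr M T X \<partial>distr M ?S W)"
      by (subst PX.nn_integral_fst[symmetric]) auto
    also have "\<dots> = (\<integral>\<^sup>+ v. (\<integral>\<^sup>+ x. ennreal (D (u, x)) * indicator B x \<partial>distr M T X) * indicator {u} v \<partial>distr M ?S W)"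
      by (intro nn_integral_cong) (auto intro!: nn_integral_cong split: split_indicator)
    also have "\<dots> = (\<integral>\<^sup>+ x. ennreal (D (u, x)) * indicator B x \<partial>distr M T X) * emeasure (distr M ?S W) {u}"
      by (subst nn_integral_cmult_indicator) auto
    also have "emeasure (distr M ?S W) {u} = ennreal (p u)"
      by (auto simp: emeasure_distr emeasure_eq_measure p_def vimage_def Int_def conj_commute)
    also have "(\<integral>\<^sup>+ x. ennreal (D (u, x)) * indicator B x \<partial>distr M T X) =
        (\<integral>\<^sup>+ \<omega>. ennreal (D (u, X \<omega>)) * indicator B (X \<omega>) \<partial>M)"
      by (subst nn_integral_distr) auto
    also have "\<dots> * ennreal (p u) = (\<integral>\<^sup>+ \<omega>. ennreal (D (u, X \<omega>)) * indicator B (X \<omega>) * ennreal (p u) \<partial>M)"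
      by (subst nn_integral_multc) auto
    also have "\<dots> = (\<integral>\<^sup>+ \<omega>. ennreal (p u * D (u, X \<omega>)) * indicator A \<omega> \<partial>M)"
      unfolding A by (intro nn_integral_cong)
        (auto simp: p_def D_def ennreal_mult mult.commute split: split_indicator)
    finally show "(\<integral>\<^sup>+ \<omega>. ennreal (p u * D (u, X \<omega>)) * indicator A \<omega> \<partial>M) =
        (\<integral>\<^sup>+ \<omega>. indicator {u} (W \<omega>) * indicator A \<omega> \<partial>M)" by simp
  qed
  have post_W: "AE \<omega> in M. posterior ?F W (W \<omega>) \<omega> = p (W \<omega>) * D (W \<omega>, X \<omega>)"
  proof -
    \<comment> \<open>The exceptional null set depends on \<open>u\<close>; uniting finitely many
      allows evaluation at the random value \<open>W \<omega>\<close>.\<close>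
    have "AE \<omega> in M. \<forall>u. posterior ?F W u \<omega> = p u * D (u, X \<omega>)"
      by (subst AE_all_countable) (use post in auto)
    then show ?thesis by eventually_elim auto
  qed
  have int_p: "integrable M (\<lambda>\<omega>. ln (p (W \<omega>)))"
    by (rule integrable_const_bound[where B = "Max (range (\<lambda>u. \<bar>ln (p u)\<bar>))"])
      (use measurable_compose[OF W] in auto)
  have "mutual_information b ?S T W X = (\<integral>z. log b (D z) \<partial>?Q)"
    by (simp add: mutual_information_def KL_divergence_def entropy_density_def D_def comp_def)
  also have "\<dots> = (\<integral>\<omega>. log b (D (W \<omega>, X \<omega>)) \<partial>M)"
    by (rule integral_distr) measurable
  also have "\<dots> = (\<integral>\<omega>. (ln (posterior ?F W (W \<omega>) \<omega>) - ln (p (W \<omega>))) / ln b \<partial>M)"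
  proof (rule integral_cong_AE)
    show "(\<lambda>\<omega>. (ln (posterior ?F W (W \<omega>) \<omega>) - ln (p (W \<omega>))) / ln b) \<in> borel_measurable M"
      by (rule measurable_compose_finite[OF W, of "\<lambda>u \<omega>. (ln (posterior ?F W u \<omega>) - ln (p u)) / ln b"]) measurable
    show "AE \<omega> in M. log b (D (W \<omega>, X \<omega>)) = (ln (posterior ?F W (W \<omega>) \<omega>) - ln (p (W \<omega>))) / ln b"
      using post_W AE_posterior_pos[OF F W]
    proof eventually_elim
      case (elim \<omega>)
      \<comment> \<open>A positive product of nonnegative factors has both factors positive, which
        the product rule for \<open>ln\<close> requires.\<close>
      have "0 \<le> p (W \<omega>)" "0 \<le> D (W \<omega>, X \<omega>)" by (auto simp: p_def D_def)
      with elim have "0 < p (W \<omega>)" "0 < D (W \<omega>, X \<omega>)" by (auto simp: zero_less_mult_iff)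
      with elim show ?case by (simp add: log_def ln_mult)
    qed
  qed measurable
  also have "\<dots> = ((\<integral>\<omega>. ln (posterior ?F W (W \<omega>) \<omega>) \<partial>M) - (\<integral>\<omega>. ln (p (W \<omega>)) \<partial>M)) / ln b"
    using integrable_ln_posterior[OF F W] int_p by simp
  finally show ?thesis by (simp add: p_def)
qed

section \<open>The data-processing inequalities\<close>

text \<open>Data processing through a random channel from \<open>X\<close> to \<open>Y\<close>:
  enlarge the observation \<open>Y\<close> to \<open>(Y, X)\<close>, then discard \<open>Y\<close>
  without changing the posterior.\<close>

lemma mutual_information_le_cond_indep:
  fixes W :: "'a \<Rightarrow> 'c :: finite"
  assumes b: "1 < b" and ci: "cond_indep_rv T Y (count_space UNIV) W V X"
  shows "mutual_information b (count_space UNIV) T W Y \<le> mutual_information b (count_space UNIV) V W X"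
proof -
  have Y[measurable]: "random_variable T Y" and W[measurable]: "random_variable (count_space UNIV) W"
    and X[measurable]: "random_variable V X"
    using ci by (auto simp: cond_indep_rv_def)
  let ?Z = "\<lambda>\<omega>. (Y \<omega>, X \<omega>)"
  let ?G = "rv_sigma (T \<Otimes>\<^sub>M V) ?Z"
  have Z: "random_variable (T \<Otimes>\<^sub>M V) ?Z" by measurable
  have "subalgebra ?G (rv_sigma T Y)"
    using subalgebra_rv_sigma_comp[OF Z measurable_fst] by simp
  then have "(\<integral>\<omega>. ln (posterior (rv_sigma T Y) W (W \<omega>) \<omega>) \<partial>M) \<le> (\<integral>\<omega>. ln (posterior ?G W (W \<omega>) \<omega>) \<partial>M)"
    by (intro integral_ln_posterior_mono subalgebra_rv_sigma Y Z W)
  also have "\<dots> = (\<integral>\<omega>. ln (posterior (rv_sigma V X) W (W \<omega>) \<omega>) \<partial>M)"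
  proof (rule integral_cong_AE)
    have "AE \<omega> in M. \<forall>u. posterior ?G W u \<omega> = posterior (rv_sigma V X) W u \<omega>"
      by (subst AE_all_countable) (use posterior_cond_indep[OF ci] in auto)
    then show "AE \<omega> in M. ln (posterior ?G W (W \<omega>) \<omega>) = ln (posterior (rv_sigma V X) W (W \<omega>) \<omega>)"
      by eventually_elim simp
  qed (use integrable_ln_posterior[OF subalgebra_rv_sigma[OF X] W]
      integrable_ln_posterior[OF subalgebra_rv_sigma[OF Z] W] in auto)
  finally show ?thesis
    using b by (simp add: mutual_information_eq_posterior[OF W] X Y divide_right_mono)
qed

text \<open>Data processing through a deterministic map, which can only shrink the generated
  sigma-algebra.\<close>

lemma mutual_information_le_comp:
  fixes W :: "'a \<Rightarrow> 'c :: finite"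
  assumes b: "1 < b" and W: "random_variable (count_space UNIV) W"
    and X: "random_variable T X" and f: "f \<in> measurable T V"
  shows "mutual_information b (count_space UNIV) V W (\<lambda>\<omega>. f (X \<omega>)) \<le> mutual_information b (count_space UNIV) T W X"
proof -
  have fX: "random_variable V (\<lambda>\<omega>. f (X \<omega>))" using X f by (rule measurable_compose)
  have "(\<integral>\<omega>. ln (posterior (rv_sigma V (\<lambda>\<omega>. f (X \<omega>))) W (W \<omega>) \<omega>) \<partial>M) \<le>
      (\<integral>\<omega>. ln (posterior (rv_sigma T X) W (W \<omega>) \<omega>) \<partial>M)"
    by (intro integral_ln_posterior_mono subalgebra_rv_sigma subalgebra_rv_sigma_comp X fX W f)
  then show ?thesis
    using b by (simp add: mutual_information_eq_posterior[OF W] X fX divide_right_mono)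
qed

end

theorem theorem4p1:
  fixes M :: "'a measure" and b :: real
    and x :: "'a \<Rightarrow> ('h::finite, 'w::finite) image"
    and w :: "'a \<Rightarrow> 'k::finite watermark"
    and E :: "('h, 'w) image \<Rightarrow> 'k watermark \<Rightarrow> ('h, 'w) image"
    and R :: "'r measure" and r :: "'a \<Rightarrow> 'r"
    and \<A> :: "('h, 'w) image \<Rightarrow> real \<Rightarrow> real \<Rightarrow> nat \<Rightarrow> 'r \<Rightarrow> ('h, 'w) image"
    and \<mu> \<sigma> :: real and s :: nat
    and \<M> :: "'t \<Rightarrow> ('h, 'w) image \<Rightarrow> ('h, 'w) image" and \<theta> :: 't
    and xw n xhat :: "'a \<Rightarrow> ('h, 'w) image"
  assumes "prob_space M" and "b > 1"
    and "x \<in> measurable M borel"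
    and "w \<in> measurable M (count_space UNIV)"
    and "(\<lambda>(v, u). E v u) \<in> measurable (borel \<Otimes>\<^sub>M count_space UNIV) borel"
    and "(\<lambda>(v, q). \<A> v \<mu> \<sigma> s q) \<in> measurable (borel \<Otimes>\<^sub>M R) borel"
    and "\<M> \<theta> \<in> measurable borel borel"
    and "\<And>\<omega>. xw \<omega> = E (x \<omega>) (w \<omega>)"
    and "prob_space.indep_rv M (count_space UNIV \<Otimes>\<^sub>M borel) (\<lambda>\<omega>. (w \<omega>, xw \<omega>)) R r"
    and "\<And>\<omega>. n \<omega> = \<A> (xw \<omega>) \<mu> \<sigma> s (r \<omega>)"
    and "\<And>\<omega>. xhat \<omega> = \<M> \<theta> (xw \<omega> + n \<omega>)"
    and "prob_space.markov_chain4 M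
           (count_space UNIV) w borel xw borel (\<lambda>\<omega>. xw \<omega> + n \<omega>) borel xhat"
  shows "prob_space.mutual_information M b (count_space UNIV) borel w xhat
           \<le> prob_space.mutual_information M b (count_space UNIV) borel w (\<lambda>\<omega>. xw \<omega> + n \<omega>)
       \<and> prob_space.mutual_information M b (count_space UNIV) borel w (\<lambda>\<omega>. xw \<omega> + n \<omega>)
           \<le> prob_space.mutual_information M b (count_space UNIV) borel w xw"
proof -
  interpret prob_space M by fact
  \<comment> \<open>This link of the chain yields the second inequality.\<close>
  have ci: "cond_indep_rv borel (\<lambda>\<omega>. xw \<omega> + n \<omega>) (count_space UNIV) w borel xw"
    using assms(12) by (simp add: markov_chain4_def)
  then have y: "random_variable borel (\<lambda>\<omega>. xw \<omega> + n \<omega>)"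
    by (simp add: cond_indep_rv_def)
  \<comment> \<open>The denoised image is a measurable function of the noisy one, which yields the
    first inequality.\<close>
  have "xhat = (\<lambda>\<omega>. \<M> \<theta> (xw \<omega> + n \<omega>))"
    using assms(11) by auto
  then show ?thesis
    using mutual_information_le_comp[OF assms(2,4) y assms(7)]
      mutual_information_le_cond_indep[OF assms(2) ci] by simp
qed

end
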